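(* Let $\theta$ be fixed, let $M(\xi,\theta)=P(\theta)C(\xi,\theta)P^T(\theta)$ be the information matrix of a design $\xi$ on $[A,B]$, where $P(\theta)$ is a nonsingular $p\times p$ matrix not depending on $\xi$ and $C(\xi,\theta)=\big(\int_A^B\Psi_{ij}(x)\,d\xi(x)\big)_{i,j=1}^p$. Let $\Psi_1,\dots,\Psi_k$ be the different functions among $\{\Psi_{ij}\mid 1\le i,j\le p\}$ that are not constant, let $\Psi_0(x)=1$, and assume that for some $l\in\{1,\dots,p\}$ $$\Psi_k=\Psi_{ll}\quad\text{and}\quad \Psi_{ij}\neq\Psi_k\ \text{ for all }(i,j)\neq(l,l).$$ (1) Suppose that $\{\Psi_0,\Psi_1,\dots,\Psi_{k-1}\}$ and $\{\Psi_0,\Psi_1,\dots,\Psi_{k-1},\Psi_k\}$ are both Chebyshev systems on $[A,B]$. Then for any design $\xi$ there exists a design $\xi^+$ with at most $\frac{k+2}{2}$ support points such that $M(\xi^+,\theta)\ge M(\xi,\theta)$. If the index of $\xi$ satisfies $I(\xi)<\frac k2$, then $\xi^+$ is uniquely determined in the class of all designs $\eta$ satisfying $$\int_A^B\Psi_i(x)\,d\eta(x)=\int_A^B\Psi_i(x)\,d\xi(x),\qquad i=0,\dots,k-1,$$ and coincides with $\xi$ (that is, $\xi$ is the only design in this class, and $\xi^+=\xi$). Otherwise, i.e. if $I(\xi)\ge\frac k2$, the following hold: (1a) if $k$ is odd, then $\xi^+$ has at most $\frac{k+1}{2}$ support points and $\xi^+$ can be chosen such that its support contains the point $B$; (1b)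 if $k$ is even, then $\xi^+$ has at most $\frac k2+1$ support points and $\xi^+$ can be chosen such that its support contains the points $A$ and $B$. (2) Suppose that $\{\Psi_0,\Psi_1,\dots,\Psi_{k-1}\}$ and $\{\Psi_0,\Psi_1,\dots,\Psi_{k-1},-\Psi_k\}$ are both Chebyshev systems on $[A,B]$. Then for any design $\xi$ there exists a design $\xi^-$ with at most $\frac{k+2}{2}$ support points such that $M(\xi^-,\theta)\ge M(\xi,\theta)$. If $I(\xi)<\frac k2$, then $\xi^-$ is uniquely determined in the class of all designs $\eta$ satisfying $\int_A^B\Psi_i\,d\eta=\int_A^B\Psi_i\,d\xi$ for $i=0,\dots,k-1$, and coincides with $\xi$ (that is, $\xi$ is the only design in this class, and $\xi^-=\xi$). Otherwise, i.e. if $I(\xi)\ge\frac k2$, the following hold: (2a) if $k$ is odd, then $\xi^-$ has at most $\frac{k+1}{2}$ support points and $\xi^-$ can be chosen such that its support contains the point $A$; (2b) if $k$ is even, then $\xi^-$ has at most $\frac k2$ support points. Here in (1a), (1b), (2a), (2b) the assertion is that a design with the stated properties exists whose information matrix is $\ge M(\xi,\theta)$.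
   Context: $[A,B]\subset\mathbb{R}$ is a compact interval (the design space). A design is a probability measure on $[A,B]$ with finite support. In the nonlinear regression model $Y=\eta(x,\theta)+\varepsilon$ with parameter $\theta\in\Theta\subset\mathbb{R}^p$, the information matrix of a design $\xi$ is $M(\xi,\theta)=\int_A^B\big(\frac{\partial}{\partial\theta}\eta(x,\theta)\big)\big(\frac{\partial}{\partial\theta}\eta(x,\theta)\big)^T d\xi(x)$; it is assumed to have the representation $M=PCP^T$ given in the claim, with functions $\Psi_{ij}=\Psi_{ji}$ on $[A,B]$ (which may depend on the fixed $\theta$). (In the integral formula $\eta$ is the regression function; in the claim $\eta$ denotes a design.) Matrix inequalities refer to the Loewner ordering: $M_1\le M_2$ means $M_2-M_1$ is nonnegative definite. The index $I(\xi)$ of a design $\xi$ is the number of its support points, where the boundary points $A$ and $B$ (if they occur as support points) are each counted only by $1/2$. A set of continuous functions $u_0,\dots,u_m:[A,B]\to\mathbb{R}$ (in this order) is a Chebyshev system on $[A,B]$ if $\det\big(u_i(x_j)\big)_{i,j=0}^m>0$ for all $A\le x_0<x_1<\dots<x_m\le B$. *)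

theory Defs
  imports "Jordan_Normal_Form.Determinant" "HOL-Probability.Probability"
begin

text \<open>A finitely supported probability measure is a \<^typ>\<open>real pmf\<close> with finite \<^const>\<open>set_pmf\<close>;
  every real function is integrable with respect to it, so the expectations below never take
  the default value of a divergent integral.\<close>

definition design :: "real \<Rightarrow> real \<Rightarrow> real pmf \<Rightarrow> bool" where
  "design A B \<xi> \<longleftrightarrow> finite (set_pmf \<xi>) \<and> set_pmf \<xi> \<subseteq> {A..B}"

definition design_index :: "real \<Rightarrow> real \<Rightarrow> real pmf \<Rightarrow> real" where
  "design_index A B \<xi> = (\<Sum>x\<in>set_pmf \<xi>. if x = A \<or> x = B then 1/2 else 1)"

text \<open>The order of the functions matters. The matrix size varies with \<open>m\<close>, hence the determinant
  of matrices with explicit dimensions; the matrices indexed by the parameter components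
  are of type \<^typ>\<open>real ^ 'p ^ 'p\<close>.\<close>

definition chebyshev_system :: "real \<Rightarrow> real \<Rightarrow> nat \<Rightarrow> (nat \<Rightarrow> real \<Rightarrow> real) \<Rightarrow> bool" where
  "chebyshev_system A B m u \<longleftrightarrow>
     (\<forall>i\<le>m. continuous_on {A..B} (u i)) \<and>
     (\<forall>x. x ` {..m} \<subseteq> {A..B} \<and> strict_mono_on {..m} x \<longrightarrow>
        Determinant.det (Matrix.mat (Suc m) (Suc m) (\<lambda>(i, j). u i (x j))) > 0)"

text \<open>\<open>v\<close> is the vector of partial derivatives of \<open>\<eta> x\<close> at \<open>\<theta>\<close>. They are taken within the parameter
  set, so that they are the ordinary ones at an interior point and one-sided ones are allowed
  at a boundary point of \<open>\<Theta>\<close>.\<close>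

definition has_param_gradient ::
  "(real \<Rightarrow> real ^ 'p \<Rightarrow> real) \<Rightarrow> (real ^ 'p) set \<Rightarrow> real ^ 'p \<Rightarrow> real \<Rightarrow> real ^ 'p \<Rightarrow> bool" where
  "has_param_gradient \<eta> \<Theta> \<theta> x v \<longleftrightarrow>
     (\<forall>i. ((\<lambda>t. \<eta> x (\<theta> + t *\<^sub>R axis i 1)) has_real_derivative v $ i)
            (at 0 within {t. \<theta> + t *\<^sub>R axis i 1 \<in> \<Theta>}))"

text \<open>\<open>g x\<close> is the gradient of the regression function with respect to the parameter at the point
  \<open>x\<close>; the matrix is integrated entrywise.\<close>

definition info_matrix :: "(real \<Rightarrow> real ^ 'p) \<Rightarrow> real pmf \<Rightarrow> real ^ 'p ^ 'p" where
  "info_matrix g \<xi> = (\<chi> i j. measure_pmf.expectation \<xi> (\<lambda>x. g x $ i * g x $ j))"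

definition moment_matrix :: "('p \<Rightarrow> 'p \<Rightarrow> real \<Rightarrow> real) \<Rightarrow> real pmf \<Rightarrow> real ^ 'p ^ 'p" where
  "moment_matrix \<Psi> \<xi> = (\<chi> i j. measure_pmf.expectation \<xi> (\<Psi> i j))"

definition nonneg_definite :: "real ^ 'p ^ 'p \<Rightarrow> bool" where
  "nonneg_definite D \<longleftrightarrow> Finite_Cartesian_Product.transpose D = D \<and> (\<forall>v. 0 \<le> v \<bullet> (D *v v))"

definition loewner_le :: "real ^ 'p ^ 'p \<Rightarrow> real ^ 'p ^ 'p \<Rightarrow> bool" where
  "loewner_le M N \<longleftrightarrow> nonneg_definite (N - M)"

definition moment_class ::
  "real \<Rightarrow> real \<Rightarrow> nat \<Rightarrow> (nat \<Rightarrow> real \<Rightarrow> real) \<Rightarrow> real pmf \<Rightarrow> real pmf set" where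
  "moment_class A B k \<psi> \<xi> = {\<zeta>. design A B \<zeta> \<and>
     (\<forall>i<k. measure_pmf.expectation \<zeta> (\<psi> i) = measure_pmf.expectation \<xi> (\<psi> i))}"

text \<open>Functions on \<open>[A,B]\<close> are compared through their restrictions. \<open>\<psi> 1, \<dots>, \<psi> k\<close> lists
  without repetition the nonconstant functions among the \<open>\<Psi> i j\<close>.\<close>

definition enumerates_nonconstant ::
  "real \<Rightarrow> real \<Rightarrow> ('p \<Rightarrow> 'p \<Rightarrow> real \<Rightarrow> real) \<Rightarrow> nat \<Rightarrow> (nat \<Rightarrow> real \<Rightarrow> real) \<Rightarrow> bool" where
  "enumerates_nonconstant A B \<Psi> k \<psi> \<longleftrightarrow>
     bij_betw (\<lambda>m. restrict (\<psi> m) {A..B}) {1..k}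
       {restrict (\<Psi> i j) {A..B} | i j. \<not> \<Psi> i j constant_on {A..B}}"

end

theory Submission
  imports Defs
begin

text \<open>On any \<open>k + 1\<close> points \<open>x\<^sub>0 < \<dots> < x\<^sub>k\<close> the cofactors of the last row of
  \<open>(\<psi>\<^sub>i(x\<^sub>j))\<close> form a signed measure with alternating signs that annihilates
  \<open>\<psi>\<^sub>0, \<dots>, \<psi>\<^sub>k\<^sub>-\<^sub>1\<close> and strictly changes the integral of \<open>\<psi>\<^sub>k\<close>. Adding multiples of such measures
  until a mass vanishes reduces the support of a design to \<open>k\<close> points without decreasing the integral of
  \<open>\<psi>\<^sub>k\<close>, so a maximizing design within the moment class exists by compactness. The support of a
  maximizer cannot contain all points \<open>x\<^sub>j\<close> at which the cofactor measure is negative, since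
  otherwise a small multiple could be added; this bounds the number of its support points.
  Conversely, the difference of two different designs with the same moments changes sign
  at least \<open>k\<close> times, so the positive part alone has index at least \<open>k / 2\<close>: a design of smaller
  index is alone in its class, and a maximizer in any other class has index at least \<open>k / 2\<close>,
  which forces the endpoints into its support. As \<open>\<Psi>\<^sub>l\<^sub>l\<close> is the only entry that varies within a moment class, comparing
  information matrices in the Loewner order amounts to comparing the integrals of \<open>\<psi>\<^sub>k\<close>.\<close>

section \<open>Finitely supported weights and their moments\<close>

text \<open>Weights are plain functions, not \<open>pmf\<close> values, so that differences of
  designs and exchange measures, which take negative values, fit the same frame.\<close>

definition moment :: "(real \<Rightarrow> real) \<Rightarrow> (real \<Rightarrow> real) \<Rightarrow> real" where
  "moment h f = (\<Sum>y | f y \<noteq> 0. f y * h y)"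

definition finite_signed :: "real \<Rightarrow> real \<Rightarrow> (real \<Rightarrow> real) \<Rightarrow> bool" where
  "finite_signed A B f \<longleftrightarrow> finite {y. f y \<noteq> 0} \<and> {y. f y \<noteq> 0} \<subseteq> {A..B}"

text \<open>The index as a function of a set, so that it also applies to part of a support, such as
  the points where a difference of weights is positive.\<close>

definition half_card :: "real \<Rightarrow> real \<Rightarrow> real set \<Rightarrow> real" where
  "half_card A B S = (\<Sum>x\<in>S. if x = A \<or> x = B then 1/2 else 1)"

lemma moment_superset:
  assumes "finite T" "{y. f y \<noteq> 0} \<subseteq> T"
  shows "moment h f = (\<Sum>y\<in>T. f y * h y)"
  unfolding moment_def by (rule sum.mono_neutral_left) (use assms in auto)

lemma moment_add_scaled:
  assumes "finite {y. f y \<noteq> 0}" "finite {y. g y \<noteq> 0}"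
  shows "moment h (\<lambda>y. f y + t * g y) = moment h f + t * moment h g"
proof -
  let ?T = "{y. f y \<noteq> 0} \<union> {y. g y \<noteq> 0}"
  have T: "finite ?T" using assms by simp
  have "moment h (\<lambda>y. f y + t * g y) = (\<Sum>y\<in>?T. (f y + t * g y) * h y)"
    by (rule moment_superset[OF T]) auto
  also have "\<dots> = (\<Sum>y\<in>?T. f y * h y) + t * (\<Sum>y\<in>?T. g y * h y)"
    by (simp add: sum.distrib sum_distrib_left algebra_simps)
  also have "(\<Sum>y\<in>?T. f y * h y) = moment h f"
    by (rule moment_superset[OF T, symmetric]) auto
  also have "(\<Sum>y\<in>?T. g y * h y) = moment h g"
    by (rule moment_superset[OF T, symmetric]) auto
  finally show ?thesis .
qed

lemma finite_signed_add_scaled: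
  assumes "finite_signed A B f" "finite_signed A B g"
  shows "finite_signed A B (\<lambda>y. f y + t * g y)"
proof -
  have "{y. f y + t * g y \<noteq> 0} \<subseteq> {y. f y \<noteq> 0} \<union> {y. g y \<noteq> 0}" by auto
  then show ?thesis
    using assms unfolding finite_signed_def by (meson finite_UnI finite_subset le_sup_iff order_trans)
qed

lemma finite_real_enumeration:
  fixes M :: "real set"
  assumes "finite M"
  obtains x where "strict_mono_on {..<card M} x" "x ` {..<card M} = M"
proof
  let ?l = "sorted_list_of_set M"
  show "strict_mono_on {..<card M} ((!) ?l)"
    using strict_sorted_list_of_set[of M] assms
    by (auto simp: strict_mono_on_def sorted_wrt_iff_nth_less)
  show "(!) ?l ` {..<card M} = M"
    using assms set_conv_nth[of ?l] by auto
qed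

text \<open>The largest multiple of \<open>D\<close> that can be added to \<open>f\<close> without reversing any sign of \<open>f\<close>
  annihilates a point of the support of \<open>f\<close>.\<close>

lemma eliminate_point:
  fixes f D :: "'a \<Rightarrow> real"
  assumes ne: "f y * D y < 0" and fin: "finite {y. f y * D y < 0}"
  obtains t y0 where "t > 0" "f y0 \<noteq> 0" "f y0 + t * D y0 = 0"
    "\<And>y. f y * (f y + t * D y) \<ge> 0"
proof -
  let ?N = "{y. f y * D y < 0}"
  define t where "t = Min ((\<lambda>y. - f y / D y) ` ?N)"
  have N: "finite ((\<lambda>y. - f y / D y) ` ?N)" "(\<lambda>y. - f y / D y) ` ?N \<noteq> {}"
    using fin ne by auto
  obtain y0 where y0: "y0 \<in> ?N" "t = - f y0 / D y0"
    using Min_in[OF N] unfolding t_def by auto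
  have pos: "- f y / D y > 0" if "y \<in> ?N" for y
    using that by (auto simp: mult_less_0_iff divide_less_0_iff)
  have t0: "t > 0" using y0 pos by simp
  have "f y * (f y + t * D y) \<ge> 0" for y
  proof (cases "y \<in> ?N")
    case True
    then have "t \<le> - f y / D y"
      unfolding t_def using fin by (intro Min_le) auto
    then have "(- f y / D y) * (f y * D y) \<le> t * (f y * D y)"
      using True by (intro mult_right_mono_neg) auto
    moreover have "(- f y / D y) * (f y * D y) = - (f y * f y)"
      using True by auto
    ultimately show ?thesis by (simp add: algebra_simps)
  next
    case False
    then have "t * (f y * D y) \<ge> 0" using t0 by simp
    then show ?thesis using zero_le_square[of "f y"] by (simp add: algebra_simps del: zero_le_square)
  qed
  moreover have "f y0 \<noteq> 0" "f y0 + t * D y0 = 0" using y0 by auto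
  ultimately show thesis using that t0 by blast
qed

text \<open>The count behind the set \<open>H\<close> in \<open>maximal_card\<close>, with
  \<open>e\<close> the parity of \<open>c\<close>: \<open>(k - e) div 2 + 1\<close> support points,
  \<open>A\<close> if \<open>e = 1\<close>, and \<open>B\<close> if \<open>k + e\<close> is odd make
  up \<open>h 0, ..., h n\<close> for \<open>n = (k + e + 1) div 2\<close>.\<close>

lemma interlacing_count:
  fixes e k :: nat
  assumes "e \<le> 1" "k \<ge> 1"
  shows "(k - e) div 2 + 1 + (e + (k + e) mod 2) = Suc ((k + e + 1) div 2)"
proof -
  have "e = 0 \<or> e = 1" using assms(1) by auto
  then show ?thesis
  proof
    assume e: "e = 0"
    show ?thesis unfolding e by simp presburger
  next
    assume e: "e = 1"
    obtain m where "k = Suc m" using assms(2) by (cases k) auto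
    then show ?thesis unfolding e by simp presburger
  qed
qed

text \<open>The parity of \<open>c\<close> tells which points carry negative weight in an exchange that increases the
  integral of \<open>u k\<close>: \<open>c = k + 1\<close> if \<open>u\<close> is a Chebyshev system, \<open>c = k\<close> if it becomes one on replacing
  \<open>u k\<close> by \<open>- u k\<close>.\<close>

locale alternating_exchange =
  fixes A B :: real and k c :: nat and u :: "nat \<Rightarrow> real \<Rightarrow> real"
  assumes AB: "A < B" and k: "k \<ge> 1"
    and u0: "\<And>x. x \<in> {A..B} \<Longrightarrow> u 0 x = 1"
    and cont: "\<And>i. i \<le> k \<Longrightarrow> continuous_on {A..B} (u i)"
    and indep: "\<And>f x. \<lbrakk>strict_mono_on {..<k} x; x ` {..<k} \<subseteq> {A..B};
        \<And>i. i < k \<Longrightarrow> (\<Sum>j<k. f (x j) * u i (x j)) = 0; j < k\<rbrakk> \<Longrightarrow> f (x j) = 0"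
    and exchange: "\<And>x. \<lbrakk>strict_mono_on {..k} x; x ` {..k} \<subseteq> {A..B}\<rbrakk> \<Longrightarrow>
        \<exists>d. (\<forall>i<k. (\<Sum>j\<le>k. d j * u i (x j)) = 0) \<and> (\<Sum>j\<le>k. d j * u k (x j)) > 0 \<and>
            (\<forall>j\<le>k. if even (j + c) then d j < 0 else d j > (0::real))"
begin

section \<open>Exchange measures and reduction of supports\<close>

text \<open>Moves the coefficients from indices to points, which is possible since \<open>x\<close>
  is injective; in this form the exchange can be added to a weight.\<close>

lemma exchange_function:
  assumes x: "strict_mono_on {..k} x" "x ` {..k} \<subseteq> {A..B}"
  obtains D where "finite_signed A B D" "{y. D y \<noteq> 0} = x ` {..k}"
    "\<And>i. i < k \<Longrightarrow> moment (u i) D = 0" "moment (u k) D > 0"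
    "\<And>j. j \<le> k \<Longrightarrow> even (j + c) \<Longrightarrow> D (x j) < 0"
    "\<And>j. j \<le> k \<Longrightarrow> odd (j + c) \<Longrightarrow> D (x j) > 0"
proof -
  obtain d where d: "\<forall>i<k. (\<Sum>j\<le>k. d j * u i (x j)) = 0" "(\<Sum>j\<le>k. d j * u k (x j)) > 0"
    "\<forall>j\<le>k. if even (j + c) then d j < 0 else d j > (0::real)"
    using exchange[OF x] by auto
  have inj: "inj_on x {..k}" using x(1) by (rule strict_mono_on_imp_inj_on)
  define D where "D y = (if y \<in> x ` {..k} then d (inv_into {..k} x y) else 0)" for y
  have Dx: "D (x j) = d j" if "j \<le> k" for j
    using that inj by (auto simp: D_def)
  have d0: "d j \<noteq> 0" if "j \<le> k" for j
    using d(3) that by (metis less_numeral_extra(3))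
  have supp: "{y. D y \<noteq> 0} = x ` {..k}"
    using Dx d0 by (auto simp: D_def)
  have m: "moment h D = (\<Sum>j\<le>k. d j * h (x j))" for h
    unfolding moment_def supp using inj Dx by (subst sum.reindex) auto
  show thesis
    by (rule that[of D]) (use d m Dx supp x in \<open>auto simp: finite_signed_def split: if_splits\<close>)
qed

lemma subset_enumeration:
  assumes "finite S" "S \<subseteq> {A..B}" "card S > k"
  obtains x where "strict_mono_on {..k} x" "x ` {..k} \<subseteq> S" 
proof -
  obtain x where x: "strict_mono_on {..<card S} x" "x ` {..<card S} = S"
    using finite_real_enumeration[OF assms(1)] by blast
  show thesis
    by (rule that[of x]) (use x assms in \<open>auto simp: strict_mono_on_def\<close>)
qed

lemma ex_even_index: "\<exists>j\<le>k. even (j + c)"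
proof -
  have "even (0 + c) \<or> even (1 + c)" by auto
  then show ?thesis using k by blast
qed

text \<open>Caratheodory elimination in a prescribed direction: with more than \<open>k\<close>
  support points, an exchange on \<open>k + 1\<close> of them increases the integral of
  \<open>u k\<close>. Since it is negative somewhere, going far enough along it removes a
  point.\<close>

lemma caratheodory_improve:
  assumes "finite_signed A B w" "\<And>y. w y \<ge> 0"
  shows "\<exists>v. finite_signed A B v \<and> (\<forall>y. v y \<ge> 0) \<and> card {y. v y \<noteq> 0} \<le> k \<and>
      (\<forall>i<k. moment (u i) v = moment (u i) w) \<and> moment (u k) v \<ge> moment (u k) w"
  using assms
proof (induction "card {y. w y \<noteq> 0}" arbitrary: w rule: less_induct)
  case less
  show ?case
  proof (cases "card {y. w y \<noteq> 0} \<le> k")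
    case True
    then show ?thesis using less.prems by blast
  next
    case False
    have fw: "finite {y. w y \<noteq> 0}" "{y. w y \<noteq> 0} \<subseteq> {A..B}"
      using less.prems by (auto simp: finite_signed_def)
    obtain x where x: "strict_mono_on {..k} x" "x ` {..k} \<subseteq> {y. w y \<noteq> 0}"
      using subset_enumeration[OF fw] False by auto
    obtain D where D: "finite_signed A B D" "{y. D y \<noteq> 0} = x ` {..k}"
      "\<And>i. i < k \<Longrightarrow> moment (u i) D = 0" "moment (u k) D > 0"
      "\<And>j. j \<le> k \<Longrightarrow> even (j + c) \<Longrightarrow> D (x j) < 0"
      "\<And>j. j \<le> k \<Longrightarrow> odd (j + c) \<Longrightarrow> D (x j) > 0"
      by (rule exchange_function[OF x(1) order_trans[OF x(2) fw(2)]]) (rule that)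
    obtain j where j: "j \<le> k" "even (j + c)" using ex_even_index by auto
    have "w (x j) \<noteq> 0" using x j by auto
    then have "w (x j) > 0" using less.prems(2)[of "x j"] by linarith
    then have "w (x j) * D (x j) < 0" using D(5)[OF j] by (simp add: mult_pos_neg)
    moreover have "finite {y. w y * D y < 0}"
      by (rule finite_subset[OF _ fw(1)]) auto
    ultimately obtain t y0 where t: "t > 0" "w y0 \<noteq> 0" "w y0 + t * D y0 = 0"
      "\<And>y. w y * (w y + t * D y) \<ge> 0"
      by (rule eliminate_point) (rule that)
    define v where "v y = w y + t * D y" for y
    have "D y = 0" if "w y = 0" for y
      using that D(2) x(2) by auto
    then have sub: "{y. v y \<noteq> 0} \<subset> {y. w y \<noteq> 0}"
      using t(2,3) by (force simp: v_def)
    have v0: "v y \<ge> 0" for y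
    proof (cases "w y = 0")
      case True
      then have "v y = 0" using sub by auto
      then show ?thesis by simp
    next
      case False
      then have "w y > 0" using less.prems(2)[of y] by linarith
      then show ?thesis using t(4)[of y] by (simp add: v_def zero_le_mult_iff)
    qed
    have fv: "finite_signed A B v"
      unfolding v_def using less.prems(1) D(1) by (rule finite_signed_add_scaled)
    have m: "moment h v = moment h w + t * moment h D" for h
      unfolding v_def using less.prems(1) D(1) by (auto intro: moment_add_scaled simp: finite_signed_def)
    obtain v' where "finite_signed A B v' \<and> (\<forall>y. v' y \<ge> 0) \<and> card {y. v' y \<noteq> 0} \<le> k \<and>
      (\<forall>i<k. moment (u i) v' = moment (u i) v) \<and> moment (u k) v' \<ge> moment (u k) v"
      using less.hyps[OF psubset_card_mono[OF fw(1) sub] fv v0] by blast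
    moreover have "moment (u k) v \<ge> moment (u k) w" using m t D(4) by simp
    ultimately show ?thesis using m D(3) by (intro exI[of _ v']) auto
  qed
qed

section \<open>Sign changes and uniqueness for small index\<close>

text \<open>The assumption \<open>indep\<close> concerns exactly \<open>k\<close> points, so the
  support is padded with points of weight zero; \<open>A < B\<close> leaves infinitely many to
  choose from.\<close>

lemma independent_weights:
  assumes f: "finite_signed A B f" and m: "\<And>i. i < k \<Longrightarrow> moment (u i) f = 0"
    and card: "card {y. f y \<noteq> 0} \<le> k"
  shows "f y = 0"
proof (rule ccontr)
  assume y: "f y \<noteq> 0"
  have fin: "finite {y. f y \<noteq> 0}" "{y. f y \<noteq> 0} \<subseteq> {A..B}"
    using f by (auto simp: finite_signed_def)
  obtain T where T: "{y. f y \<noteq> 0} \<subseteq> T" "T \<subseteq> {A..B}" "card T = k" "finite T"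
  proof -
    have "infinite ({A..B} - {y. f y \<noteq> 0})"
      using fin AB by (simp add: infinite_Icc)
    then obtain U where U: "U \<subseteq> {A..B} - {y. f y \<noteq> 0}" "card U = k - card {y. f y \<noteq> 0}" "finite U"
      by (meson infinite_arbitrarily_large)
    have "{y. f y \<noteq> 0} \<inter> U = {}" using U by auto
    then have "card ({y. f y \<noteq> 0} \<union> U) = k" using U fin card by (simp add: card_Un_disjoint)
    then show thesis
      by (intro that[of "{y. f y \<noteq> 0} \<union> U"]) (use U fin in auto)
  qed
  obtain x where x: "strict_mono_on {..<k} x" "x ` {..<k} = T"
    using finite_real_enumeration[OF T(4)] T(3) by auto
  have "inj_on x {..<k}" using x(1) by (rule strict_mono_on_imp_inj_on)
  then have s: "(\<Sum>j<k. f (x j) * h (x j)) = moment h f" for h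
    unfolding moment_superset[OF T(4,1)] x(2)[symmetric] by (subst sum.reindex) auto
  have "y \<in> x ` {..<k}" using x y T by blast
  then obtain j where "j < k" "x j = y" by blast
  then show False
    using indep[OF x(1), of f j] s m y x T by auto
qed

text \<open>If some sign of \<open>f\<close> disagrees with an exchange \<open>D\<close> on
  \<open>k + 1\<close> of its support points, adding a multiple of \<open>D\<close> removes a
  support point and keeps all remaining signs, so an alternation of the smaller weight is one of
  \<open>f\<close>. The descent ends when \<open>f\<close> has the signs of \<open>D\<close> or is a
  negative multiple of \<open>D\<close>.\<close>

lemma annihilating_weights_alternate:
  assumes "finite_signed A B f" "\<And>i. i < k \<Longrightarrow> moment (u i) f = 0" "f z \<noteq> 0"
  shows "\<exists>x b. strict_mono_on {..k} x \<and> x ` {..k} \<subseteq> {A..B} \<and>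
      (\<forall>j\<le>k. if even (j + b) then f (x j) > 0 else f (x j) < 0)"
  using assms
proof (induction "card {y. f y \<noteq> 0}" arbitrary: f z rule: less_induct)
  case less
  have ff: "finite {y. f y \<noteq> 0}" "{y. f y \<noteq> 0} \<subseteq> {A..B}"
    using less.prems by (auto simp: finite_signed_def)
  have "card {y. f y \<noteq> 0} > k"
  proof (rule ccontr)
    assume "\<not> card {y. f y \<noteq> 0} > k"
    then have "card {y. f y \<noteq> 0} \<le> k" by simp
    with less.prems(1,2) have "f z = 0" by (rule independent_weights)
    then show False using less.prems(3) by simp
  qed
  then obtain x where x: "strict_mono_on {..k} x" "x ` {..k} \<subseteq> {y. f y \<noteq> 0}"
    using subset_enumeration[OF ff] by auto
  obtain D where D: "finite_signed A B D" "{y. D y \<noteq> 0} = x ` {..k}"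
    "\<And>i. i < k \<Longrightarrow> moment (u i) D = 0" "moment (u k) D > 0"
    "\<And>j. j \<le> k \<Longrightarrow> even (j + c) \<Longrightarrow> D (x j) < 0"
    "\<And>j. j \<le> k \<Longrightarrow> odd (j + c) \<Longrightarrow> D (x j) > 0"
    by (rule exchange_function[OF x(1) order_trans[OF x(2) ff(2)]]) (rule that)
  have fx: "f (x j) \<noteq> 0" if "j \<le> k" for j using x(2) that by auto
  have xAB: "x ` {..k} \<subseteq> {A..B}" using x ff by blast
  show ?case
  proof (cases "\<exists>y. f y * D y < 0")
    case False
    have nn: "f (x j) * D (x j) \<ge> 0" for j using False by (meson not_le)
    \<comment> \<open>\<open>f\<close> is positive where \<open>D\<close> is, that is at odd
      \<open>j + c\<close>; hence the shift \<open>c + 1\<close>.\<close>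
    have "if even (j + c + 1) then f (x j) > 0 else f (x j) < 0" if "j \<le> k" for j
      using nn[of j] D(5,6)[OF that] fx[OF that]
      by (auto simp: zero_le_mult_iff)
    then show ?thesis
      using x(1) xAB by (intro exI[of _ x] exI[of _ "c + 1"]) (auto simp: add.assoc)
  next
    case True
    then obtain y where "f y * D y < 0" ..
    moreover have "finite {y. f y * D y < 0}"
      by (rule finite_subset[OF _ ff(1)]) auto
    ultimately obtain t y0 where t: "t > 0" "f y0 \<noteq> 0" "f y0 + t * D y0 = 0"
      "\<And>y. f y * (f y + t * D y) \<ge> 0"
      by (rule eliminate_point) (rule that)
    define g where "g y = f y + t * D y" for y
    have "D y = 0" if "f y = 0" for y
      using that D(2) x(2) by auto
    then have sub: "{y. g y \<noteq> 0} \<subset> {y. f y \<noteq> 0}"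
      using t(2,3) by (force simp: g_def)
    have fg: "finite_signed A B g"
      unfolding g_def using less.prems(1) D(1) by (rule finite_signed_add_scaled)
    have m: "moment h g = moment h f + t * moment h D" for h
      unfolding g_def using less.prems(1) D(1) by (auto intro: moment_add_scaled simp: finite_signed_def)
    have m0: "moment (u i) g = 0" if "i < k" for i using m less.prems(2) D(3) that by simp
    show ?thesis
    proof (cases "\<exists>z. g z \<noteq> 0")
      case False
      then have g0: "f y = - (t * D y)" for y by (simp add: g_def add_eq_0_iff2)
      have "if even (j + c) then f (x j) > 0 else f (x j) < 0" if "j \<le> k" for j
        using D(5,6)[OF that] t(1) by (auto simp: g0 mult_pos_neg)
      then show ?thesis
        using x(1) xAB by (intro exI[of _ x] exI[of _ c]) auto
    next
      case True
      then obtain z' where "g z' \<noteq> 0" by auto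
      then obtain x' b where x': "strict_mono_on {..k} x'" "x' ` {..k} \<subseteq> {A..B}"
        "\<forall>j\<le>k. if even (j + b) then g (x' j) > 0 else g (x' j) < 0"
        using less.hyps[OF psubset_card_mono[OF ff(1) sub] fg m0] by blast
      have "f y \<noteq> 0" if "g y \<noteq> 0" for y using sub that by auto
      then have sg: "(g y > 0 \<longrightarrow> f y > 0) \<and> (g y < 0 \<longrightarrow> f y < 0)" for y
        using t(4)[of y] unfolding g_def[symmetric]
        by (smt (verit) zero_le_mult_iff)
      then show ?thesis using x' by (intro exI[of _ x'] exI[of _ b]) (metis (full_types))
    qed
  qed
qed


text \<open>Of two neighbouring indices exactly one has the chosen parity. Summing over the
  \<open>k\<close> neighbouring pairs counts inner indices twice and \<open>0\<close> and
  \<open>k\<close> once. Only \<open>x 0\<close> can equal \<open>A\<close> and only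
  \<open>x k\<close> can equal \<open>B\<close>, so halving at the endpoints costs no more than
  halving at the end indices.\<close>

lemma half_card_alternating:
  assumes x: "strict_mono_on {..k} x" "x ` {..k} \<subseteq> {A..B}"
  shows "half_card A B (x ` {j. j \<le> k \<and> even (j + b)}) \<ge> real k / 2"
proof -
  define \<sigma> where "\<sigma> j = (if even (j + b) then 1 else (0::real))" for j
  let ?h = "\<lambda>j. if j = 0 \<or> j = k then 1/2 else (1::real)"
  have inj: "inj_on x {..k}" using x(1) by (rule strict_mono_on_imp_inj_on)
  have "\<sigma> j + \<sigma> (Suc j) = 1" for j by (simp add: \<sigma>_def)
  then have "real k = (\<Sum>j<k. \<sigma> j + \<sigma> (Suc j))"
    by simp
  also have "\<dots> = (\<Sum>j<k. \<sigma> j) + (\<Sum>j<k. \<sigma> (Suc j))"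
    by (rule sum.distrib)
  also have "(\<Sum>j<k. \<sigma> j) = (\<Sum>j\<le>k. \<sigma> j) - \<sigma> k"
    by (simp add: lessThan_Suc_atMost[symmetric])
  also have "(\<Sum>j<k. \<sigma> (Suc j)) = (\<Sum>j\<le>k. \<sigma> j) - \<sigma> 0"
    using sum.lessThan_Suc_shift[of \<sigma> k] by (simp add: lessThan_Suc_atMost[symmetric])
  also have "(\<Sum>j\<le>k. \<sigma> j) - \<sigma> k + ((\<Sum>j\<le>k. \<sigma> j) - \<sigma> 0)
      = 2 * (\<Sum>j\<le>k. \<sigma> j - (if j = 0 then \<sigma> j / 2 else 0) - (if j = k then \<sigma> j / 2 else 0))"
    by (simp add: sum_subtractf)
  also have "(\<Sum>j\<le>k. \<sigma> j - (if j = 0 then \<sigma> j / 2 else 0) - (if j = k then \<sigma> j / 2 else 0))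
      = (\<Sum>j\<le>k. if even (j + b) then ?h j else 0)"
    using k by (intro sum.cong) (auto simp: \<sigma>_def)
  also have "\<dots> = (\<Sum>j | j \<le> k \<and> even (j + b). ?h j)"
    by (simp add: sum.inter_filter[symmetric])
  also have "\<dots> \<le> (\<Sum>j | j \<le> k \<and> even (j + b). if x j = A \<or> x j = B then 1/2 else 1)"
  proof (rule sum_mono)
    fix j assume "j \<in> {j. j \<le> k \<and> even (j + b)}"
    then have j: "j \<le> k" by simp
    have "x 0 \<ge> A" "x k \<le> B" using x(2) by auto
    moreover have "x 0 < x j" if "j \<noteq> 0"
      using that j x(1) by (auto simp: strict_mono_on_def)
    moreover have "x j < x k" if "j \<noteq> k"
      using that j x(1) by (auto simp: strict_mono_on_def)
    ultimately show "?h j \<le> (if x j = A \<or> x j = B then 1/2 else 1)"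
      by auto
  qed
  also have "\<dots> = half_card A B (x ` {j. j \<le> k \<and> even (j + b)})"
    unfolding half_card_def
    by (subst sum.reindex) (auto intro: inj_on_subset[OF inj])
  finally show ?thesis by simp
qed

lemma half_card_mono:
  assumes "finite T" "S \<subseteq> T"
  shows "half_card a b S \<le> half_card a b T"
  unfolding half_card_def using assms by (intro sum_mono2) auto

text \<open>A nonzero difference \<open>w - v\<close> would alternate on \<open>k + 1\<close>
  points. Where it is positive, \<open>w > v \<ge> 0\<close>, so these points lie in the support of
  \<open>w\<close> and alone contribute at least \<open>k / 2\<close> to its index.\<close>

lemma small_index_unique:
  assumes w: "finite_signed A B w" "\<And>y. w y \<ge> 0" and v: "finite_signed A B v" "\<And>y. v y \<ge> 0"
    and m: "\<And>i. i < k \<Longrightarrow> moment (u i) v = moment (u i) w"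
    and index: "half_card A B {y. w y \<noteq> 0} < real k / 2"
  shows "v = w"
proof (rule ccontr)
  assume "v \<noteq> w"
  then obtain z where z: "v z \<noteq> w z" by auto
  define f where "f y = w y + (-1) * v y" for y
  have "finite_signed A B f"
    unfolding f_def by (rule finite_signed_add_scaled) fact+
  moreover have "moment (u i) f = 0" if "i < k" for i
    unfolding f_def using w(1) v(1) m[OF that]
    by (subst moment_add_scaled) (auto simp: finite_signed_def)
  moreover have "f z \<noteq> 0" using z by (simp add: f_def)
  ultimately obtain x b where x: "strict_mono_on {..k} x" "x ` {..k} \<subseteq> {A..B}"
    "\<forall>j\<le>k. if even (j + b) then f (x j) > 0 else f (x j) < 0"
    using annihilating_weights_alternate[of f z] by blast
  have "w (x j) \<noteq> 0" if "j \<le> k" "even (j + b)" for j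
    using x(3) that v(2)[of "x j"] by (auto simp: f_def)
  then have "x ` {j. j \<le> k \<and> even (j + b)} \<subseteq> {y. w y \<noteq> 0}" by auto
  then have "half_card A B (x ` {j. j \<le> k \<and> even (j + b)}) \<le> half_card A B {y. w y \<noteq> 0}"
    using w(1) by (intro half_card_mono) (auto simp: finite_signed_def)
  then show False using half_card_alternating[OF x(1,2), of b] index by simp
qed

section \<open>Existence of a maximizer by compactness\<close>

lemma moment_u0:
  assumes "finite_signed A B w"
  shows "moment (u 0) w = (\<Sum>y | w y \<noteq> 0. w y)"
  unfolding moment_def using assms u0 by (intro sum.cong) (auto simp: finite_signed_def)

text \<open>Points may coincide, in which case their masses add up; insisting on distinct points
  would destroy the compactness of the parameter set.\<close>

lemma weights_of_points:
  fixes z :: "nat \<Rightarrow> real \<times> real"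
  assumes "\<And>j. z j \<in> {A..B} \<times> {0..1}"
  obtains v where "finite_signed A B v" "\<And>y. v y \<ge> 0"
    "\<And>h. moment h v = (\<Sum>j<n. snd (z j) * h (fst (z j)))"
proof
  define v where "v y = (\<Sum>j<n. if fst (z j) = y then snd (z j) else 0)" for y
  let ?T = "(fst \<circ> z) ` {..<n}"
  have T: "finite ?T" by simp
  have supp: "{y. v y \<noteq> 0} \<subseteq> ?T"
  proof clarify
    fix y assume "v y \<noteq> 0"
    then obtain j where "j \<in> {..<n}" "(if fst (z j) = y then snd (z j) else 0) \<noteq> 0"
      unfolding v_def by (rule sum.not_neutral_contains_not_neutral)
    then show "y \<in> ?T" by (auto split: if_splits)
  qed
  have z: "fst (z j) \<in> {A..B}" "snd (z j) \<ge> 0" for j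
    using assms[of j] by (cases "z j"; simp)+
  show "finite_signed A B v"
    unfolding finite_signed_def
  proof
    show "finite {y. v y \<noteq> 0}" using supp T by (rule finite_subset)
    have "?T \<subseteq> {A..B}" using z(1) by auto
    then show "{y. v y \<noteq> 0} \<subseteq> {A..B}" using supp by (rule order_trans[rotated])
  qed
  show "v y \<ge> 0" for y unfolding v_def using z by (intro sum_nonneg) auto
  show "moment h v = (\<Sum>j<n. snd (z j) * h (fst (z j)))" for h
  proof -
    have "moment h v = (\<Sum>y\<in>?T. \<Sum>j<n. if fst (z j) = y then snd (z j) * h y else 0)"
      unfolding moment_superset[OF T supp] v_def sum_distrib_right by (intro sum.cong) auto
    also have "\<dots> = (\<Sum>j<n. \<Sum>y\<in>?T. if fst (z j) = y then snd (z j) * h y else 0)"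
      by (rule sum.swap)
    also have "\<dots> = (\<Sum>j<n. snd (z j) * h (fst (z j)))"
      by (intro sum.cong) (auto simp: sum.delta')
    finally show ?thesis .
  qed
qed

lemma points_of_weights:
  assumes v: "finite_signed A B v" "\<And>y. v y \<ge> 0" and card: "card {y. v y \<noteq> 0} \<le> k"
    and one: "moment (u 0) v = 1"
  obtains z :: "nat \<Rightarrow> real \<times> real" where "\<And>j. z j \<in> {A..B} \<times> {0..1}"
    "\<And>h. moment h v = (\<Sum>j<k. snd (z j) * h (fst (z j)))"
proof -
  let ?S = "{y. v y \<noteq> 0}"
  have fin: "finite ?S" "?S \<subseteq> {A..B}" using v by (auto simp: finite_signed_def)
  obtain x where x: "strict_mono_on {..<card ?S} x" "x ` {..<card ?S} = ?S"
    using finite_real_enumeration[OF fin(1)] by blast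
  have inj: "inj_on x {..<card ?S}" using x(1) by (rule strict_mono_on_imp_inj_on)
  \<comment> \<open>Missing points are replaced by mass 0 at \<open>A\<close>, so that all supports
    of at most \<open>k\<close> points share one parameter set.\<close>
  define z where "z j = (if j < card ?S then (x j, v (x j)) else (A, 0))" for j
  have le1: "v y \<le> 1" for y
  proof (cases "v y = 0")
    case False
    then have "v y \<le> (\<Sum>y | v y \<noteq> 0. v y)"
      using fin v by (intro member_le_sum) auto
    then show ?thesis using one moment_u0[OF v(1)] by simp
  qed auto
  show thesis
  proof (rule that[of z])
    fix j
    have "x j \<in> {A..B}" if "j < card ?S" using that x(2) fin(2) by blast
    then show "z j \<in> {A..B} \<times> {0..1}"
      using v(2) le1 AB by (auto simp: z_def)
  next
    fix h :: "real \<Rightarrow> real"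
    have "(\<Sum>j<k. snd (z j) * h (fst (z j))) = (\<Sum>j<card ?S. snd (z j) * h (fst (z j)))"
      using card by (intro sum.mono_neutral_right) (auto simp: z_def)
    also have "\<dots> = (\<Sum>j<card ?S. v (x j) * h (x j))"
      by (intro sum.cong) (auto simp: z_def)
    also have "\<dots> = (\<Sum>y\<in>x ` {..<card ?S}. v y * h y)"
      using inj by (subst sum.reindex) auto
    also have "\<dots> = moment h v"
      unfolding x(2) moment_def ..
    finally show "moment h v = (\<Sum>j<k. snd (z j) * h (fst (z j)))" ..
  qed
qed

text \<open>Competitors may have any finite support: the given design and the perturbations of
  \<open>w\<close> by exchanges can have more than \<open>k\<close> points.\<close>

definition maximal :: "(real \<Rightarrow> real) \<Rightarrow> bool" where
  "maximal w \<longleftrightarrow> finite_signed A B w \<and> (\<forall>y. w y \<ge> 0) \<and>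
    (\<forall>v. finite_signed A B v \<and> (\<forall>y. v y \<ge> 0) \<and> (\<forall>i<k. moment (u i) v = moment (u i) w) \<longrightarrow>
      moment (u k) v \<le> moment (u k) w)"

text \<open>Weights with at most \<open>k\<close> points and the prescribed moments are parametrized
  by a compact set on which the integral of \<open>u k\<close> is continuous; by
  \<open>caratheodory_improve\<close> larger supports do no better.\<close>

lemma maximal_exists:
  assumes w: "finite_signed A B w" "\<And>y. w y \<ge> 0" and one: "moment (u 0) w = 1"
  shows "\<exists>v. maximal v \<and> (\<forall>i<k. moment (u i) v = moment (u i) w)"
proof -
  define F :: "nat \<Rightarrow> (nat \<Rightarrow> real \<times> real) \<Rightarrow> real"
    where "F i z = (\<Sum>j<k. snd (z j) * u i (fst (z j)))" for i z
  \<comment> \<open>Sequences over all of \<open>nat\<close>, of which only the first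
    \<open>k\<close> entries are read: the full product is compact by Tychonoff and carries the
    topology of the function type.\<close>
  define K :: "(nat \<Rightarrow> real \<times> real) set" where "K = (\<Pi>\<^sub>E j\<in>UNIV. {A..B} \<times> {0..1})"
  have KI: "z \<in> K \<longleftrightarrow> (\<forall>j. z j \<in> {A..B} \<times> {0..1})" for z
    by (auto simp: K_def PiE_def Pi_def)
  have "compactin (product_topology (\<lambda>_. euclidean) UNIV) K"
    unfolding K_def compactin_PiE by (auto intro: compact_Times)
  then have compK: "compact K" by (simp add: euclidean_product_topology)
  have contF: "continuous_on K (F i)" if "i \<le> k" for i
  proof -
    have c: "continuous_on K (\<lambda>z. z j)" for j
      by (rule continuous_on_subset[OF continuous_on_product_coordinates]) simp
    have "continuous_on K (\<lambda>z. u i (fst (z j)))" for j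
      by (rule continuous_on_compose2[OF cont[OF that]])
        (auto intro!: continuous_on_fst c simp: KI mem_Times_iff)
    then show ?thesis
      unfolding F_def by (intro continuous_intros c)
  qed
  define Z where "Z = K \<inter> (\<Inter>i\<in>{..<k}. {z \<in> K. F i z = moment (u i) w})"
  have compZ: "compact Z"
    unfolding Z_def
    by (intro compact_Int_closed compK closed_INT ballI continuous_closed_preimage_constant contF
      compact_imp_closed) auto
  have represent: "\<exists>z\<in>Z. moment (u k) v \<le> F k z"
    if v: "finite_signed A B v" "\<And>y. v y \<ge> 0" "\<And>i. i < k \<Longrightarrow> moment (u i) v = moment (u i) w" for v
  proof -
    obtain v' where v': "finite_signed A B v'" "\<forall>y. v' y \<ge> 0" "card {y. v' y \<noteq> 0} \<le> k"
      "\<forall>i<k. moment (u i) v' = moment (u i) v" "moment (u k) v' \<ge> moment (u k) v"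
      using caratheodory_improve[OF v(1,2)] by blast
    have "moment (u 0) v' = 1" using v'(4) v(3) one k by simp
    with v'(1) spec[OF v'(2)] v'(3) obtain z where "\<And>j. z j \<in> {A..B} \<times> {0..1}"
      "\<And>h. moment h v' = (\<Sum>j<k. snd (z j) * h (fst (z j)))"
      by (rule points_of_weights) (rule that)
    then show ?thesis
      using v' v(3) by (intro bexI[of _ z]) (auto simp: Z_def KI F_def)
  qed
  have "Z \<noteq> {}" using represent[OF w] by auto
  moreover have "continuous_on Z (F k)"
    by (rule continuous_on_subset[OF contF]) (auto simp: Z_def)
  ultimately obtain z where z: "z \<in> Z" "\<And>z'. z' \<in> Z \<Longrightarrow> F k z' \<le> F k z"
    using continuous_attains_sup[OF compZ] by blast
  have "z \<in> K" using z by (simp add: Z_def)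
  then have "\<And>j. z j \<in> {A..B} \<times> {0..1}" by (simp add: KI)
  then obtain v where v: "finite_signed A B v" "\<And>y. v y \<ge> 0"
    "\<And>h. moment h v = (\<Sum>j<k. snd (z j) * h (fst (z j)))"
    by (rule weights_of_points[where n = k]) (rule that)
  have F: "moment (u i) v = F i z" for i by (simp add: v(3) F_def)
  have mv: "\<forall>i<k. moment (u i) v = moment (u i) w" using z(1) by (auto simp: F Z_def)
  have "moment (u k) v' \<le> moment (u k) v"
    if v': "finite_signed A B v'" "\<And>y. v' y \<ge> 0" "\<And>i. i < k \<Longrightarrow> moment (u i) v' = moment (u i) v" for v'
  proof -
    have "moment (u i) v' = moment (u i) w" if "i < k" for i
      using that mv v'(3) by simp
    then obtain z' where "z' \<in> Z" "moment (u k) v' \<le> F k z'"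
      using represent[OF v'(1,2)] by blast
    then show ?thesis using z(2)[of z'] F[of k] by simp
  qed
  then have "maximal v" unfolding maximal_def using v by blast
  then show ?thesis using mv by blast
qed

section \<open>The support of a maximizer\<close>

text \<open>With mass at every point where the exchange is negative, a positive multiple of it could
  be added within the class, raising the integral of \<open>u k\<close>. Points where the exchange
  is positive need no mass.\<close>

lemma maximal_no_exchange:
  assumes w: "maximal w" and x: "strict_mono_on {..k} x" "x ` {..k} \<subseteq> {A..B}"
  shows "\<exists>j\<le>k. even (j + c) \<and> w (x j) = 0"
proof (rule ccontr)
  assume neg: "\<not> (\<exists>j\<le>k. even (j + c) \<and> w (x j) = 0)"
  have fw: "finite_signed A B w" and w0: "\<And>y. w y \<ge> 0"
    using w by (auto simp: maximal_def)
  obtain D where D: "finite_signed A B D" "{y. D y \<noteq> 0} = x ` {..k}"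
    "\<And>i. i < k \<Longrightarrow> moment (u i) D = 0" "moment (u k) D > 0"
    "\<And>j. j \<le> k \<Longrightarrow> even (j + c) \<Longrightarrow> D (x j) < 0"
    "\<And>j. j \<le> k \<Longrightarrow> odd (j + c) \<Longrightarrow> D (x j) > 0"
    by (rule exchange_function[OF x]) (rule that)
  \<comment> \<open>\<open>eliminate_point\<close> gives no control where \<open>w\<close> vanishes,
    so the exchange must not be negative there.\<close>
  have Dneg: "w y \<noteq> 0" if "D y < 0" for y
  proof -
    have "y \<in> x ` {..k}" using that D(2) by auto
    then obtain j where j: "j \<le> k" "y = x j" by auto
    then have "even (j + c)" using D(6)[of j] that by fastforce
    then show ?thesis using neg j by auto
  qed
  obtain j where j: "j \<le> k" "even (j + c)" using ex_even_index by auto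
  have "w (x j) > 0" using neg j w0[of "x j"] by (metis order_less_le)
  then have "w (x j) * D (x j) < 0" using D(5)[OF j] by (simp add: mult_pos_neg)
  moreover have "finite {y. w y * D y < 0}"
    by (rule finite_subset[of _ "{y. w y \<noteq> 0}"]) (use fw in \<open>auto simp: finite_signed_def\<close>)
  ultimately obtain t y0 where t: "t > 0" "w y0 \<noteq> 0" "w y0 + t * D y0 = 0"
      "\<And>y. w y * (w y + t * D y) \<ge> 0"
    by (rule eliminate_point) (rule that)
  define v where "v y = w y + t * D y" for y
  have v0: "v y \<ge> 0" for y
  proof (cases "w y = 0")
    case True
    then have "D y \<ge> 0" using Dneg[of y] by linarith
    then show ?thesis using True t(1) by (simp add: v_def)
  next
    case False
    then have "w y > 0" using w0[of y] by linarith
    then show ?thesis using t(4)[of y] by (simp add: v_def zero_le_mult_iff)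
  qed
  have fv: "finite_signed A B v"
    unfolding v_def using fw D(1) by (rule finite_signed_add_scaled)
  have m: "moment h v = moment h w + t * moment h D" for h
    unfolding v_def using fw D(1) by (auto intro: moment_add_scaled simp: finite_signed_def)
  have "moment (u k) v \<le> moment (u k) w"
    using w fv v0 m D(3) unfolding maximal_def by auto
  moreover have "t * moment (u k) D > 0" using t(1) D(4) by simp
  ultimately show False using m[of "u k"] by simp
qed


text \<open>The bound is one less than the number of \<open>j \<le> k\<close> with
  \<open>even (j + c)\<close>, so one more support point would allow an exchange that takes mass
  only from the support. If the first exchange point gains mass, it needs room to the left of the
  chosen support points, for which \<open>A\<close> is set aside; likewise \<open>B\<close> for the
  last one.\<close>

lemma maximal_card:
  assumes w: "maximal w"
  shows "card ({y. w y \<noteq> 0} - (if odd c then {A} else {}) - (if odd (k + c) then {B} else {}))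
    \<le> (k - c mod 2) div 2"
proof (rule ccontr)
  define EA where "EA = (if odd c then {A} else {})"
  define EB where "EB = (if odd (k + c) then {B} else {})"
  \<comment> \<open>\<open>e = 1\<close> exactly if the first exchange point gains mass; the shift
    by \<open>e\<close> makes \<open>even (j + c)\<close> equivalent to \<open>j + e\<close> being
    twice an index of \<open>h\<close>.\<close>
  define e where "e = c mod 2"
  define n where "n = (k + e + 1) div 2"
  have e: "e = 0 \<and> even c \<or> e = 1 \<and> odd c" by (auto simp: e_def odd_iff_mod_2_eq_one)
  assume "\<not> ?thesis"
  then have "card ({y. w y \<noteq> 0} - EA - EB) \<ge> (k - e) div 2 + 1"
    by (simp add: EA_def EB_def e_def)
  then obtain R where R: "R \<subseteq> {y. w y \<noteq> 0} - EA - EB" "card R = (k - e) div 2 + 1" "finite R"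
    by (meson obtain_subset_with_card_n)
  have supp: "{y. w y \<noteq> 0} \<subseteq> {A..B}" using w by (auto simp: maximal_def finite_signed_def)
  define H where "H = R \<union> (EA \<union> EB)"
  have fin: "finite H" "H \<subseteq> {A..B}"
    using R supp AB by (auto simp: H_def EA_def EB_def)
  have "card H = card R + card (EA \<union> EB)"
    unfolding H_def using R by (intro card_Un_disjoint) (auto simp: EA_def EB_def)
  also have "card (EA \<union> EB) = card EA + card EB"
    using AB by (intro card_Un_disjoint) (auto simp: EA_def EB_def)
  also have "card R + (card EA + card EB) = Suc n"
  proof -
    have "card EA = e" using e by (auto simp: EA_def)
    moreover have "(k + e) mod 2 = (if odd (k + c) then 1 else 0)" using e by presburger
    then have "card EB = (k + e) mod 2" by (simp add: EB_def)
    moreover have "e \<le> 1" using e by auto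
    ultimately show ?thesis using interlacing_count[of e k] k unfolding R(2) n_def by simp
  qed
  finally have cardH: "card H = Suc n" .
  obtain h where h: "strict_mono_on {..<Suc n} h" "h ` {..<Suc n} = H"
    using finite_real_enumeration[OF fin(1)] unfolding cardH by blast
  have less: "h i < h j" if "i < j" "j \<le> n" for i j
    using h(1) that by (auto simp: strict_mono_on_def)
  have le: "h i \<le> h j" if "i \<le> j" "j \<le> n" for i j
    using less[of i j] that by (cases "i = j") auto
  have hH: "h i \<in> H" if "i \<le> n" for i using that h(2) by auto
  \<comment> \<open>The \<open>x j\<close> with \<open>even (j + c)\<close> run through \<open>R\<close>; the others are midpoints of neighbours in \<open>H\<close>.\<close>
  define x where "x j = (h ((j + e) div 2) + h ((j + e + 1) div 2)) / 2" for j
  have idx: "(j + e) div 2 \<le> n" "(j + e + 1) div 2 \<le> n" if "j \<le> k" for j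
    using that by (auto simp: n_def intro!: div_le_mono)
  have "x ` {..k} \<subseteq> {A..B}"
  proof (rule image_subsetI)
    fix j assume "j \<in> {..k}"
    then have "h ((j + e) div 2) \<in> {A..B}" "h ((j + e + 1) div 2) \<in> {A..B}"
      using idx[of j] hH fin(2) by (auto simp del: atLeastAtMost_iff)
    then show "x j \<in> {A..B}" by (auto simp: x_def)
  qed
  moreover have "strict_mono_on {..k} x"
  proof (rule strict_mono_onI)
    fix i j assume ij: "i \<in> {..k}" "j \<in> {..k}" "i < j"
    \<comment> \<open>As the index grows, neither rounded half decreases and one of them increases,
      so the average of values of the increasing \<open>h\<close> increases.\<close>
    then have "(i + e) div 2 < (j + e) div 2 \<and> (i + e + 1) div 2 \<le> (j + e + 1) div 2 \<or>
      (i + e) div 2 \<le> (j + e) div 2 \<and> (i + e + 1) div 2 < (j + e + 1) div 2"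
      by presburger
    then show "x i < x j"
      using less[of "(i + e) div 2" "(j + e) div 2"] le[of "(i + e) div 2" "(j + e) div 2"]
        less[of "(i + e + 1) div 2" "(j + e + 1) div 2"] le[of "(i + e + 1) div 2" "(j + e + 1) div 2"]
        idx[of j] ij
      by (auto simp: x_def)
  qed
  ultimately obtain j where j: "j \<le> k" "even (j + c)" "w (x j) = 0"
    using maximal_no_exchange[OF w] by blast
  have "even (j + e)" using j(2) e by auto
  then obtain i where i: "j + e = 2 * i" by blast
  have xj: "x j = h i" unfolding x_def i by simp
  have "i \<le> n" using idx(1)[OF j(1)] i by simp
  \<comment> \<open>\<open>h i = A\<close> would force \<open>i = 0\<close> although
    \<open>j + e = 2 * i\<close> with \<open>e = 1\<close>; similarly \<open>h i = B\<close> would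
    force \<open>i = n\<close> and \<open>j = k + 1\<close>. Only \<open>R\<close> remains.\<close>
  have "h i \<notin> EA"
  proof
    assume "h i \<in> EA"
    then have "h i = A" "e = 1" using e by (auto simp: EA_def split: if_splits)
    moreover have "h 0 \<ge> A" using hH[of 0] fin(2) by auto
    ultimately have "i = 0" using less[of 0 i] \<open>i \<le> n\<close> by force
    then show False using i \<open>e = 1\<close> by simp
  qed
  moreover have "h i \<notin> EB"
  proof
    assume "h i \<in> EB"
    then have "h i = B" "odd (k + e)" using e by (auto simp: EB_def split: if_splits)
    moreover have "h n \<le> B" using hH[of n] fin(2) by auto
    ultimately have "i = n" using less[of i n] \<open>i \<le> n\<close> by force
    then have "j + e = k + e + 1" using i \<open>odd (k + e)\<close> by (auto simp: n_def)
    then show False using j(1) by simp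
  qed
  ultimately have "h i \<in> R" using hH[OF \<open>i \<le> n\<close>] by (auto simp: H_def)
  then show False using R(1) j(3) xj by auto
qed

section \<open>From weights back to designs\<close>

lemma expectation_mom:
  assumes "finite (set_pmf p)"
  shows "measure_pmf.expectation p h = moment h (pmf p)"
proof -
  have "measure_pmf.expectation p h = (\<Sum>y\<in>set_pmf p. h y * pmf p y)"
    by (rule integral_measure_pmf_real[OF assms]) auto
  then show ?thesis unfolding moment_def by (simp add: set_pmf_eq mult.commute)
qed

lemma design_finite_signed: "design A B p \<longleftrightarrow> finite_signed A B (pmf p)"
  by (simp add: design_def finite_signed_def set_pmf_eq)

lemma pmf_of_weights:
  assumes w: "finite_signed A B w" "\<And>y. w y \<ge> 0" and one: "moment (u 0) w = 1"
  obtains p where "pmf p = w"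
proof
  have fin: "finite {y. w y \<noteq> 0}" using w by (simp add: finite_signed_def)
  have "(\<integral>\<^sup>+x. ennreal (w x) \<partial>count_space UNIV) = (\<Sum>x | w x \<noteq> 0. ennreal (w x))"
    using fin by (intro nn_integral_count_space') auto
  also have "\<dots> = 1"
    using w one moment_u0[OF w(1)] by (simp add: sum_ennreal)
  finally have "(\<integral>\<^sup>+x. ennreal (w x) \<partial>count_space UNIV) = 1" .
  then show "pmf (embed_pmf w) = w"
    using w(2) by (intro ext pmf_embed_pmf) auto
qed

lemma moment_u0_pmf:
  assumes "design A B p"
  shows "moment (u 0) (pmf p) = 1"
proof -
  have "finite_signed A B (pmf p)" using assms by (simp add: design_finite_signed)
  then have "moment (u 0) (pmf p) = (\<Sum>y\<in>set_pmf p. pmf p y)"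
    by (simp add: moment_u0 set_pmf_eq)
  then show ?thesis using assms by (simp add: sum_pmf_eq_1 design_def)
qed

lemma design_index_half_card: "design_index A B p = half_card A B {y. pmf p y \<noteq> 0}"
  by (simp add: design_index_def half_card_def set_pmf_eq)

lemma design_expectation:
  "design A B p \<Longrightarrow> measure_pmf.expectation p h = moment h (pmf p)"
  by (simp add: expectation_mom design_def)

lemma moment_class_small_index:
  assumes \<xi>: "design A B \<xi>" and index: "design_index A B \<xi> < real k / 2"
  shows "moment_class A B k u \<xi> = {\<xi>}"
proof (intro equalityI subsetI)
  fix \<zeta> assume "\<zeta> \<in> moment_class A B k u \<xi>"
  then have \<zeta>: "design A B \<zeta>" "\<forall>i<k. moment (u i) (pmf \<zeta>) = moment (u i) (pmf \<xi>)"
    using \<xi> by (auto simp: moment_class_def design_expectation)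
  have "pmf \<zeta> = pmf \<xi>"
    using \<xi> \<zeta> index unfolding design_finite_signed design_index_half_card
    by (intro small_index_unique) auto
  then show "\<zeta> \<in> {\<xi>}" by (simp add: pmf_eq_iff)
qed (use \<xi> in \<open>auto simp: moment_class_def\<close>)

lemma extremal_design:
  assumes \<xi>: "design A B \<xi>" and index: "design_index A B \<xi> \<ge> real k / 2"
  obtains \<zeta> where "\<zeta> \<in> moment_class A B k u \<xi>"
    "measure_pmf.expectation \<zeta> (u k) \<ge> measure_pmf.expectation \<xi> (u k)"
    "design_index A B \<zeta> \<ge> real k / 2"
    "card (set_pmf \<zeta> - (if odd c then {A} else {}) - (if odd (k + c) then {B} else {}))
       \<le> (k - c mod 2) div 2"
proof -
  have f\<xi>: "finite_signed A B (pmf \<xi>)" using \<xi> by (simp add: design_finite_signed)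
  obtain v where v: "maximal v" "\<forall>i<k. moment (u i) v = moment (u i) (pmf \<xi>)"
    using maximal_exists[OF f\<xi> _ moment_u0_pmf[OF \<xi>]] by auto
  have v': "finite_signed A B v" "\<And>y. v y \<ge> 0" using v(1) by (auto simp: maximal_def)
  have "moment (u 0) v = 1" using v(2) k moment_u0_pmf[OF \<xi>] by simp
  with v' obtain \<zeta> where \<zeta>: "pmf \<zeta> = v" by (rule pmf_of_weights)
  have d: "design A B \<zeta>" using v'(1) by (simp add: design_finite_signed \<zeta>)
  have cls: "\<zeta> \<in> moment_class A B k u \<xi>"
    using d \<xi> v(2) by (simp add: moment_class_def design_expectation \<zeta>)
  have ge: "measure_pmf.expectation \<zeta> (u k) \<ge> measure_pmf.expectation \<xi> (u k)"
    using v f\<xi> d \<xi> by (simp add: design_expectation \<zeta> maximal_def)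
  have ind: "design_index A B \<zeta> \<ge> real k / 2"
  proof (rule ccontr)
    assume small: "\<not> ?thesis"
    \<comment> \<open>A maximizer of small index would be alone in its class and thus equal to
      \<open>\<xi>\<close>, whose index is not small.\<close>
    have "pmf \<xi> = v"
      using small v' v(2) f\<xi> unfolding design_index_half_card \<zeta>
      by (intro small_index_unique) auto
    then have "\<xi> = \<zeta>" by (simp add: pmf_eq_iff \<zeta>)
    then show False using small index by simp
  qed
  show thesis
    by (rule that[OF cls ge ind]) (use maximal_card[OF v(1)] in \<open>simp add: set_pmf_eq \<zeta>\<close>)
qed

end

section \<open>Independence and exchanges from Chebyshev systems\<close>

text \<open>The coefficients form a kernel vector of a collocation matrix with positive determinant.
  Since \<open>k - 1\<close> is the largest index, the system has \<open>k\<close>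
  functions.\<close>

lemma chebyshev_independent:
  assumes ch: "chebyshev_system A B (k - 1) u" and k: "k \<ge> 1"
    and x: "strict_mono_on {..<k} x" "x ` {..<k} \<subseteq> {A..B}"
    and zero: "\<And>i. i < k \<Longrightarrow> (\<Sum>j<k. a j * u i (x j)) = 0" and j: "j < k"
  shows "a j = 0"
proof (rule ccontr)
  assume aj: "a j \<noteq> 0"
  define M where "M = Matrix.mat k k (\<lambda>(i, j). u i (x j))"
  define v where "v = Matrix.vec k a"
  have M: "M \<in> carrier_mat k k" by (simp add: M_def)
  have "{..k - 1} = {..<k}" using k by auto
  then have "Determinant.det M > 0"
    using ch x k by (simp add: chebyshev_system_def M_def)
  moreover have "M *\<^sub>v v = 0\<^sub>v k"
    using zero by (intro eq_vecI) (auto simp: M_def v_def scalar_prod_def atLeast0LessThan mult.commute)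
  moreover have "vec_index v j \<noteq> vec_index (0\<^sub>v k) j" using aj j by (simp add: v_def)
  then have "v \<noteq> 0\<^sub>v k" by auto
  moreover have "v \<in> carrier_vec k" by (simp add: v_def)
  ultimately show False
    using det_0_iff_vec_prod_zero[OF M] by auto
qed

text \<open>The cofactors of the last row of the collocation matrix are orthogonal to its other rows,
  and they alternate in sign because the minors are again Chebyshev determinants.\<close>

lemma chebyshev_exchange:
  assumes ch1: "chebyshev_system A B (k - 1) u" and ch: "chebyshev_system A B k u" and k: "k \<ge> 1"
    and x: "strict_mono_on {..k} x" "x ` {..k} \<subseteq> {A..B}"
  shows "\<exists>d. (\<forall>i<k. (\<Sum>j\<le>k. d j * u i (x j)) = 0) \<and> (\<Sum>j\<le>k. d j * u k (x j)) > 0 \<and>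
    (\<forall>j\<le>k. if even (j + k) then d j > 0 else d j < (0::real))"
proof -
  define M where "M = Matrix.mat (Suc k) (Suc k) (\<lambda>(i, j). u i (x j))"
  have M: "M \<in> carrier_mat (Suc k) (Suc k)" by (simp add: M_def)
  have detM: "Determinant.det M > 0" using ch x by (simp add: chebyshev_system_def M_def)
  define d where "d j = cofactor M k j" for j
  have row: "(\<Sum>j\<le>k. d j * u i (x j)) = (if i = k then Determinant.det M else 0)" if "i \<le> k" for i
  proof -
    \<comment> \<open>Column \<open>k\<close> of the adjugate holds the cofactors of row
      \<open>k\<close>.\<close>
    have "(\<Sum>j\<le>k. d j * u i (x j)) = (M * adj_mat M) $$ (i, k)"
      using that by (simp add: M_def adj_mat_def scalar_prod_def d_def atLeast0LessThan
          lessThan_Suc_atMost mult.commute)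
    also have "\<dots> = (if i = k then Determinant.det M else 0)"
      using that by (simp add: adj_mat(2)[OF M])
    finally show ?thesis .
  qed
  have "if even (j + k) then d j > 0 else d j < 0" if j: "j \<le> k" for j
  proof -
    \<comment> \<open>\<open>y\<close> lists the \<open>k\<close> points other than
      \<open>x j\<close>, so the minor is a determinant of the smaller Chebyshev system.\<close>
    define y where "y i = x (if i < j then i else Suc i)" for i
    have "mat_delete M k j = Matrix.mat k k (\<lambda>(i, j). u i (y j))"
      by (rule eq_matI) (use j in \<open>auto simp: mat_delete_def M_def y_def\<close>)
    moreover have "strict_mono_on {..k - 1} y"
      unfolding y_def using j k by (intro strict_mono_onI strict_mono_onD[OF x(1)]) auto
    moreover have "y ` {..k - 1} \<subseteq> {A..B}"
      using x(2) j k by (auto simp: y_def)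
    ultimately have "Determinant.det (mat_delete M k j) > 0"
      using ch1 k by (simp add: chebyshev_system_def)
    then show ?thesis by (simp add: d_def cofactor_def add.commute)
  qed
  then show ?thesis using row detM by (intro exI[of _ d]) auto
qed

lemma chebyshev_system_cong:
  assumes "\<And>i. i \<le> m \<Longrightarrow> u i = v i"
  shows "chebyshev_system A B m u = chebyshev_system A B m v"
proof -
  have "Matrix.mat (Suc m) (Suc m) (\<lambda>(i, j). u i (x j)) = Matrix.mat (Suc m) (Suc m) (\<lambda>(i, j). v i (x j))"
    for x :: "nat \<Rightarrow> real"
    by (rule eq_matI) (use assms in auto)
  then show ?thesis using assms by (simp add: chebyshev_system_def)
qed

section \<open>Comparison in the Loewner order\<close>

lemma design_expectation_cong:
  assumes "design A B p" "\<And>x. x \<in> {A..B} \<Longrightarrow> f x = h x"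
  shows "measure_pmf.expectation p f = measure_pmf.expectation p h"
  using assms unfolding design_def
  by (intro integral_cong_AE) (auto simp: AE_measure_pmf_iff subset_iff)

lemma nonneg_definite_congruence:
  fixes P :: "real ^ 'q ^ 'p" and D :: "real ^ 'q ^ 'q"
  assumes "nonneg_definite D"
  shows "nonneg_definite (P ** D ** Finite_Cartesian_Product.transpose P)"
proof -
  have "v \<bullet> ((P ** D ** Finite_Cartesian_Product.transpose P) *v v)
      = (v v* P) \<bullet> (D *v (v v* P))" for v
    by (simp add: dot_lmul_matrix matrix_vector_mul_assoc[symmetric])
  then show ?thesis
    using assms by (simp add: nonneg_definite_def matrix_transpose_mul matrix_mul_assoc)
qed

lemma nonneg_definite_single_entry:
  assumes "\<delta> \<ge> 0"
  shows "nonneg_definite (\<chi> i j. if i = l \<and> j = l then \<delta> else 0 :: real ^ 'p ^ 'p)"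
proof -
  let ?D = "\<chi> i j. if i = l \<and> j = l then \<delta> else 0 :: real ^ 'p ^ 'p"
  have "?D *v v = (\<chi> i. if i = l then \<delta> * v $ l else 0)" for v
  proof -
    have "(\<Sum>j\<in>UNIV. (if i = l \<and> j = l then \<delta> else 0) * v $ j)
        = (\<Sum>j\<in>UNIV. if j = l then (if i = l then \<delta> * v $ l else 0) else 0)" for i
      by (intro sum.cong) auto
    then show ?thesis by (simp add: vec_eq_iff matrix_vector_mult_def)
  qed
  then have "v \<bullet> (?D *v v) = \<delta> * (v $ l)\<^sup>2" for v
    by (simp add: inner_vec_def if_distrib power2_eq_square cong: if_cong)
  moreover have "Finite_Cartesian_Product.transpose ?D = ?D"
    by (auto simp: vec_eq_iff Finite_Cartesian_Product.transpose_def)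
  ultimately show ?thesis using assms by (simp add: nonneg_definite_def)
qed

lemma matrix_mul_diff:
  fixes M :: "real ^ 'p ^ 'q"
  shows "M ** (N - L) ** K = M ** N ** K - M ** L ** K"
  by (simp add: vec_eq_iff matrix_matrix_mult_def algebra_simps sum_subtractf)

text \<open>Constant entries have the same expectation under every design, and a nonconstant entry
  other than \<open>(l, l)\<close> is some \<open>\<psi> m\<close> with \<open>m < k\<close>, whose
  expectation is fixed in the class. The moment matrices thus differ in the entry
  \<open>(l, l)\<close> only, by a nonnegative amount, and congruence with \<open>P\<close>
  preserves nonnegative definiteness.\<close>

lemma info_matrix_improves:
  fixes g :: "real \<Rightarrow> real ^ 'p"
  assumes info: "\<And>\<xi>. design A B \<xi> \<Longrightarrow>
           info_matrix g \<xi> = P ** moment_matrix \<Psi> \<xi> ** Finite_Cartesian_Product.transpose P"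
    and enum: "enumerates_nonconstant A B \<Psi> k \<psi>"
    and l: "\<And>x. x \<in> {A..B} \<Longrightarrow> \<psi> k x = \<Psi> l l x"
    and sep: "\<And>i j. (i, j) \<noteq> (l, l) \<Longrightarrow> \<exists>x\<in>{A..B}. \<Psi> i j x \<noteq> \<psi> k x"
    and \<xi>: "design A B \<xi>" and \<zeta>: "\<zeta> \<in> moment_class A B k \<psi> \<xi>"
    and ge: "measure_pmf.expectation \<zeta> (\<psi> k) \<ge> measure_pmf.expectation \<xi> (\<psi> k)"
  shows "loewner_le (info_matrix g \<xi>) (info_matrix g \<zeta>)"
proof -
  have d\<zeta>: "design A B \<zeta>" using \<zeta> by (simp add: moment_class_def)
  define \<delta> where "\<delta> = measure_pmf.expectation \<zeta> (\<psi> k) - measure_pmf.expectation \<xi> (\<psi> k)"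
  have entry: "measure_pmf.expectation \<zeta> (\<Psi> i j) - measure_pmf.expectation \<xi> (\<Psi> i j)
      = (if i = l \<and> j = l then \<delta> else 0)" for i j
  proof (cases "i = l \<and> j = l")
    case True
    have "measure_pmf.expectation \<zeta> (\<psi> k) = measure_pmf.expectation \<zeta> (\<Psi> l l)"
      "measure_pmf.expectation \<xi> (\<psi> k) = measure_pmf.expectation \<xi> (\<Psi> l l)"
      using d\<zeta> \<xi> l by (auto intro: design_expectation_cong)
    then show ?thesis using True by (simp add: \<delta>_def)
  next
    case False
    have "measure_pmf.expectation \<zeta> (\<Psi> i j) = measure_pmf.expectation \<xi> (\<Psi> i j)"
    proof (cases "\<Psi> i j constant_on {A..B}")
      case True
      then obtain r where r: "\<And>x. x \<in> {A..B} \<Longrightarrow> \<Psi> i j x = r" by (auto simp: constant_on_def)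
      then have "measure_pmf.expectation p (\<Psi> i j) = r" if "design A B p" for p
        using design_expectation_cong[OF that, of "\<Psi> i j" "\<lambda>_. r"] by simp
      then show ?thesis using d\<zeta> \<xi> by simp
    next
      case nonconst: False
      then have "restrict (\<Psi> i j) {A..B} \<in> (\<lambda>m. restrict (\<psi> m) {A..B}) ` {1..k}"
        using enum unfolding enumerates_nonconstant_def bij_betw_def by blast
      then obtain m where m: "m \<in> {1..k}" "restrict (\<Psi> i j) {A..B} = restrict (\<psi> m) {A..B}"
        by blast
      have eq: "\<Psi> i j x = \<psi> m x" if "x \<in> {A..B}" for x
        using fun_cong[OF m(2), of x] that by simp
      have "m \<noteq> k" using sep[of i j] False eq by auto
      then have "measure_pmf.expectation \<zeta> (\<psi> m) = measure_pmf.expectation \<xi> (\<psi> m)"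
        using m(1) \<zeta> by (simp add: moment_class_def)
      then show ?thesis
        using design_expectation_cong[OF d\<zeta> eq] design_expectation_cong[OF \<xi> eq] by simp
    qed
    then show ?thesis using False by auto
  qed
  have "moment_matrix \<Psi> \<zeta> - moment_matrix \<Psi> \<xi> = (\<chi> i j. if i = l \<and> j = l then \<delta> else 0)"
    by (simp add: vec_eq_iff moment_matrix_def entry)
  moreover have "nonneg_definite (\<chi> i j. if i = l \<and> j = l then \<delta> else 0)"
    by (rule nonneg_definite_single_entry) (use ge in \<open>simp add: \<delta>_def\<close>)
  ultimately have "nonneg_definite
      (P ** (moment_matrix \<Psi> \<zeta> - moment_matrix \<Psi> \<xi>) ** Finite_Cartesian_Product.transpose P)"
    by (intro nonneg_definite_congruence) simp
  then show ?thesis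
    by (simp add: loewner_le_def info \<xi> d\<zeta> matrix_mul_diff)
qed

section \<open>Counting inner support points and endpoints\<close>

text \<open>Expresses each count by the inner points and one term per endpoint, so that the bounds
  of the theorem become linear inequalities.\<close>

lemma card_split_endpoints:
  assumes "finite S" "A \<noteq> B"
  shows "card (S - {A}) = card (S - {A, B}) + (if B \<in> S then 1 else 0)"
    and "card (S - {B}) = card (S - {A, B}) + (if A \<in> S then 1 else 0)"
    and "card S = card (S - {A, B}) + (if A \<in> S then 1 else 0) + (if B \<in> S then 1 else 0)"
proof -
  have *: "card T = card (T - {x}) + (if x \<in> T then 1 else 0)" if "finite T" for T and x :: 'a
  proof (cases "x \<in> T")
    case True
    then show ?thesis using card.remove[OF that True] by (simp only: if_True Suc_eq_plus1)
  qed simp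
  have eq: "S - {A} - {B} = S - {A, B}" "S - {B} - {A} = S - {A, B}" by auto
  show 1: "card (S - {A}) = card (S - {A, B}) + (if B \<in> S then 1 else 0)"
    using *[of "S - {A}" B] assms unfolding eq by (simp only: finite_Diff) auto
  show "card (S - {B}) = card (S - {A, B}) + (if A \<in> S then 1 else 0)"
    using *[of "S - {B}" A] assms unfolding eq by (simp only: finite_Diff) auto
  show "card S = card (S - {A, B}) + (if A \<in> S then 1 else 0) + (if B \<in> S then 1 else 0)"
    unfolding *[OF assms(1), of A] 1 by (simp only: ac_simps)
qed

lemma design_index_split_endpoints:
  assumes "design A B p" "A \<noteq> B"
  shows "design_index A B p = real (card (set_pmf p - {A, B})) + (if A \<in> set_pmf p then 1/2 else 0)
    + (if B \<in> set_pmf p then 1/2 else 0)"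
proof -
  have fin: "finite (set_pmf p)" using assms by (simp add: design_def)
  have "design_index A B p = (\<Sum>x\<in>set_pmf p \<inter> {A, B}. if x = A \<or> x = B then 1/2 else 1)
      + (\<Sum>x\<in>set_pmf p - {A, B}. if x = A \<or> x = B then 1/2 else 1)"
    unfolding design_index_def by (rule sum.Int_Diff[OF fin])
  also have "(\<Sum>x\<in>set_pmf p - {A, B}. if x = A \<or> x = B then 1/2 else (1::real))
      = (\<Sum>x\<in>set_pmf p - {A, B}. 1)"
    by (intro sum.cong) auto
  also have "(\<Sum>x\<in>set_pmf p \<inter> {A, B}. if x = A \<or> x = B then 1/2 else (1::real))
      = (if A \<in> set_pmf p then 1/2 else 0) + (if B \<in> set_pmf p then 1/2 else 0)"
    using assms(2) by (auto simp: Int_insert_right)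
  finally show ?thesis by simp
qed

text \<open>The index undercounts each endpoint by 1/2, so the cardinality exceeds it by at most
  1.\<close>

lemma small_index_card:
  assumes "design A B p" "A \<noteq> B" "design_index A B p < real k / 2"
  shows "real (card (set_pmf p)) \<le> (real k + 2) / 2"
proof -
  have fin: "finite (set_pmf p)" using assms by (simp add: design_def)
  show ?thesis
    using assms(3)
    unfolding design_index_split_endpoints[OF assms(1,2)] card_split_endpoints(3)[OF fin assms(2)]
    by (auto split: if_splits)
qed

lemma loewner_le_refl: "loewner_le M M"
  by (simp add: loewner_le_def nonneg_definite_def vec_eq_iff Finite_Cartesian_Product.transpose_def)

theorem theorem3p1:
  fixes A B :: real
    and \<eta> :: "real \<Rightarrow> real ^ 'p \<Rightarrow> real"
    and \<Theta> :: "(real ^ 'p) set"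
    and \<theta> :: "real ^ 'p"
    and g :: "real \<Rightarrow> real ^ 'p"
    and P :: "real ^ 'p ^ 'p"
    and \<Psi> :: "'p \<Rightarrow> 'p \<Rightarrow> real \<Rightarrow> real"
    and \<psi> :: "nat \<Rightarrow> real \<Rightarrow> real"
    and k :: nat
    and l :: 'p
  assumes "A < B"
    and "\<theta> \<in> \<Theta>"
    and "\<And>x. x \<in> {A..B} \<Longrightarrow> has_param_gradient \<eta> \<Theta> \<theta> x (g x)"
    and "\<And>i j x. x \<in> {A..B} \<Longrightarrow> \<Psi> i j x = \<Psi> j i x"
    and "invertible P"
    and "\<And>\<xi>. design A B \<xi> \<Longrightarrow>
           info_matrix g \<xi> = P ** moment_matrix \<Psi> \<xi> ** Finite_Cartesian_Product.transpose P"
    and "k \<ge> 1"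
    and "\<And>x. x \<in> {A..B} \<Longrightarrow> \<psi> 0 x = 1"
    and "enumerates_nonconstant A B \<Psi> k \<psi>"
    and "\<And>x. x \<in> {A..B} \<Longrightarrow> \<psi> k x = \<Psi> l l x"
    and "\<And>i j. (i, j) \<noteq> (l, l) \<Longrightarrow> \<exists>x\<in>{A..B}. \<Psi> i j x \<noteq> \<psi> k x"
  shows
    "(chebyshev_system A B (k - 1) \<psi> \<and> chebyshev_system A B k \<psi> \<longrightarrow>
        (\<forall>\<xi>. design A B \<xi> \<longrightarrow>
          (\<exists>\<xi>p. design A B \<xi>p \<and> real (card (set_pmf \<xi>p)) \<le> (real k + 2) / 2 \<and>
             loewner_le (info_matrix g \<xi>) (info_matrix g \<xi>p) \<and>
             (design_index A B \<xi> < real k / 2 \<longrightarrow> moment_class A B k \<psi> \<xi> = {\<xi>} \<and> \<xi>p = \<xi>) \<and>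
             (design_index A B \<xi> \<ge> real k / 2 \<longrightarrow>
                (odd k \<longrightarrow> real (card (set_pmf \<xi>p)) \<le> (real k + 1) / 2 \<and> B \<in> set_pmf \<xi>p) \<and>
                (even k \<longrightarrow> real (card (set_pmf \<xi>p)) \<le> real k / 2 + 1 \<and>
                   A \<in> set_pmf \<xi>p \<and> B \<in> set_pmf \<xi>p))))) \<and>
     (chebyshev_system A B (k - 1) \<psi> \<and> chebyshev_system A B k (\<psi>(k := \<lambda>x. - \<psi> k x)) \<longrightarrow>
        (\<forall>\<xi>. design A B \<xi> \<longrightarrow>
          (\<exists>\<xi>m. design A B \<xi>m \<and> real (card (set_pmf \<xi>m)) \<le> (real k + 2) / 2 \<and>
             loewner_le (info_matrix g \<xi>) (info_matrix g \<xi>m) \<and>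
             (design_index A B \<xi> < real k / 2 \<longrightarrow> moment_class A B k \<psi> \<xi> = {\<xi>} \<and> \<xi>m = \<xi>) \<and>
             (design_index A B \<xi> \<ge> real k / 2 \<longrightarrow>
                (odd k \<longrightarrow> real (card (set_pmf \<xi>m)) \<le> (real k + 1) / 2 \<and> A \<in> set_pmf \<xi>m) \<and>
                (even k \<longrightarrow> real (card (set_pmf \<xi>m)) \<le> real k / 2)))))"
proof (intro conjI impI allI)
  have A_neq_B: "A \<noteq> B" using assms(1) by simp
  have improves: "loewner_le (info_matrix g \<xi>) (info_matrix g \<zeta>)"
    if "design A B \<xi>" "\<zeta> \<in> moment_class A B k \<psi> \<xi>"
      "measure_pmf.expectation \<zeta> (\<psi> k) \<ge> measure_pmf.expectation \<xi> (\<psi> k)" for \<xi> \<zeta>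
    using assms(6) assms(9-11) that by (rule info_matrix_improves)
  {
    fix \<xi>
    assume ch: "chebyshev_system A B (k - 1) \<psi> \<and> chebyshev_system A B k \<psi>" and \<xi>: "design A B \<xi>"
    \<comment> \<open>The cofactors are positive at even \<open>j + k\<close>, so mass is taken away
      at even \<open>j + (k + 1)\<close>.\<close>
    interpret alternating_exchange A B k "k + 1" \<psi>
    proof
      show "f (x j) = 0" if "strict_mono_on {..<k} x" "x ` {..<k} \<subseteq> {A..B}"
        "\<And>i. i < k \<Longrightarrow> (\<Sum>j<k. f (x j) * \<psi> i (x j)) = 0" "j < k" for f x j
        using chebyshev_independent[of A B k \<psi> x "\<lambda>j. f (x j)" j] that ch assms(7) by blast
      show "\<exists>d. (\<forall>i<k. (\<Sum>j\<le>k. d j * \<psi> i (x j)) = 0) \<and> (\<Sum>j\<le>k. d j * \<psi> k (x j)) > 0 \<and>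
            (\<forall>j\<le>k. if even (j + (k + 1)) then d j < 0 else d j > (0::real))"
        if x: "strict_mono_on {..k} x" "x ` {..k} \<subseteq> {A..B}" for x
      proof -
        obtain d where "\<forall>i<k. (\<Sum>j\<le>k. d j * \<psi> i (x j)) = 0" "(\<Sum>j\<le>k. d j * \<psi> k (x j)) > 0"
          "\<forall>j\<le>k. if even (j + k) then d j > 0 else d j < (0::real)"
          using chebyshev_exchange[OF _ _ assms(7) x, of \<psi>] ch by blast
        then show ?thesis by (intro exI[of _ d]) auto
      qed
    qed (use assms ch in \<open>auto simp: chebyshev_system_def\<close>)
    show "\<exists>\<xi>p. design A B \<xi>p \<and> real (card (set_pmf \<xi>p)) \<le> (real k + 2) / 2 \<and>
             loewner_le (info_matrix g \<xi>) (info_matrix g \<xi>p) \<and>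
             (design_index A B \<xi> < real k / 2 \<longrightarrow> moment_class A B k \<psi> \<xi> = {\<xi>} \<and> \<xi>p = \<xi>) \<and>
             (design_index A B \<xi> \<ge> real k / 2 \<longrightarrow>
                (odd k \<longrightarrow> real (card (set_pmf \<xi>p)) \<le> (real k + 1) / 2 \<and> B \<in> set_pmf \<xi>p) \<and>
                (even k \<longrightarrow> real (card (set_pmf \<xi>p)) \<le> real k / 2 + 1 \<and>
                   A \<in> set_pmf \<xi>p \<and> B \<in> set_pmf \<xi>p))"
    proof (cases "design_index A B \<xi> < real k / 2")
      case True
      then show ?thesis
        using \<xi> small_index_card[OF \<xi> A_neq_B True] moment_class_small_index[OF \<xi> True]
        by (intro exI[of _ \<xi>]) (auto simp: loewner_le_refl)
    next
      case False
      then have "design_index A B \<xi> \<ge> real k / 2" by simp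
      with \<xi> obtain \<zeta> where \<zeta>: "\<zeta> \<in> moment_class A B k \<psi> \<xi>"
        "measure_pmf.expectation \<zeta> (\<psi> k) \<ge> measure_pmf.expectation \<xi> (\<psi> k)"
        "design_index A B \<zeta> \<ge> real k / 2"
        "card (set_pmf \<zeta> - (if odd (k + 1) then {A} else {}) -
            (if odd (k + (k + 1)) then {B} else {})) \<le> (k - (k + 1) mod 2) div 2"
        by (rule extremal_design) (rule that)
      have d: "design A B \<zeta>" using \<zeta>(1) by (simp add: moment_class_def)
      then have fin: "finite (set_pmf \<zeta>)" by (simp add: design_def)
      define n where "n = card (set_pmf \<zeta> - {A, B})"
      note split = card_split_endpoints[OF fin A_neq_B, folded n_def]
        and index = \<zeta>(3)[unfolded design_index_split_endpoints[OF d A_neq_B], folded n_def]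
      have odd: "real (card (set_pmf \<zeta>)) \<le> (real k + 1) / 2 \<and> B \<in> set_pmf \<zeta>" if "odd k"
      proof -
        from that obtain m where m: "k = 2 * m + 1" by (rule oddE)
        have "card (set_pmf \<zeta> - {B}) \<le> m" using \<zeta>(4) by (simp add: m)
        \<comment> \<open>At most \<open>m\<close> points differ from \<open>B\<close>, while the
          index is at least \<open>m + 1/2\<close>: this forces \<open>B\<close> into the support
          and \<open>A\<close> out of it.\<close>
        then show ?thesis using index unfolding split by (auto simp: m split: if_splits)
      qed
      have even: "real (card (set_pmf \<zeta>)) \<le> real k / 2 + 1 \<and> A \<in> set_pmf \<zeta> \<and> B \<in> set_pmf \<zeta>"
        if "even k"
      proof -
        from that obtain m where m: "k = 2 * m" by (rule evenE)
        have "set_pmf \<zeta> - {A} - {B} = set_pmf \<zeta> - {A, B}" by auto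
        then have "n \<le> (2 * m - 1) div 2" using \<zeta>(4) by (simp add: m n_def)
        then have "n + 1 \<le> m" using assms(7) unfolding m by linarith
        \<comment> \<open>At most \<open>m - 1\<close> inner points and an index of at least
          \<open>m\<close> leave a gap of 1, which only both endpoints together can fill.\<close>
        then show ?thesis using index unfolding split by (auto simp: m split: if_splits)
      qed
      show ?thesis
        using d improves[OF \<xi> \<zeta>(1,2)] False odd even
        by (intro exI[of _ \<zeta>]) (cases "even k"; auto)
    qed
  next
    fix \<xi>
    assume ch: "chebyshev_system A B (k - 1) \<psi> \<and>
      chebyshev_system A B k (\<psi>(k := \<lambda>x. - \<psi> k x))" and \<xi>: "design A B \<xi>"
    let ?v = "\<psi>(k := \<lambda>x. - \<psi> k x)"
    have ch': "chebyshev_system A B (k - 1) ?v"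
    proof -
      have "chebyshev_system A B (k - 1) \<psi> = chebyshev_system A B (k - 1) ?v"
        by (rule chebyshev_system_cong) (use assms(7) in auto)
      then show ?thesis using ch by simp
    qed
    interpret alternating_exchange A B k k \<psi>
    proof
      show "f (x j) = 0" if "strict_mono_on {..<k} x" "x ` {..<k} \<subseteq> {A..B}"
        "\<And>i. i < k \<Longrightarrow> (\<Sum>j<k. f (x j) * \<psi> i (x j)) = 0" "j < k" for f x j
        using chebyshev_independent[of A B k \<psi> x "\<lambda>j. f (x j)" j] that ch assms(7) by blast
      show "\<exists>d. (\<forall>i<k. (\<Sum>j\<le>k. d j * \<psi> i (x j)) = 0) \<and> (\<Sum>j\<le>k. d j * \<psi> k (x j)) > 0 \<and>
            (\<forall>j\<le>k. if even (j + k) then d j < 0 else d j > (0::real))"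
        if x: "strict_mono_on {..k} x" "x ` {..k} \<subseteq> {A..B}" for x
      proof -
        obtain d where "\<forall>i<k. (\<Sum>j\<le>k. d j * ?v i (x j)) = 0" "(\<Sum>j\<le>k. d j * ?v k (x j)) > 0"
          "\<forall>j\<le>k. if even (j + k) then d j > 0 else d j < (0::real)"
          using chebyshev_exchange[OF ch' _ assms(7) x] ch by blast
        \<comment> \<open>Negating \<open>d\<close> turns the increase for \<open>- \<psi> k\<close>
          into one for \<open>\<psi> k\<close> and reverses the sign pattern, whence
          \<open>c = k\<close>.\<close>
        then show ?thesis by (intro exI[of _ "\<lambda>j. - d j"]) (auto simp: sum_negf)
      qed
      show "continuous_on {A..B} (\<psi> i)" if "i \<le> k" for i
      proof (cases "i = k")
        case True
        have "continuous_on {A..B} (?v k)" using ch unfolding chebyshev_system_def by blast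
        then have "continuous_on {A..B} (\<lambda>x. - ?v k x)" by (rule continuous_on_minus)
        then show ?thesis using True by simp
      next
        case False
        then show ?thesis using that ch by (simp add: chebyshev_system_def)
      qed
    qed (use assms in auto)
    show "\<exists>\<xi>m. design A B \<xi>m \<and> real (card (set_pmf \<xi>m)) \<le> (real k + 2) / 2 \<and>
             loewner_le (info_matrix g \<xi>) (info_matrix g \<xi>m) \<and>
             (design_index A B \<xi> < real k / 2 \<longrightarrow> moment_class A B k \<psi> \<xi> = {\<xi>} \<and> \<xi>m = \<xi>) \<and>
             (design_index A B \<xi> \<ge> real k / 2 \<longrightarrow>
                (odd k \<longrightarrow> real (card (set_pmf \<xi>m)) \<le> (real k + 1) / 2 \<and> A \<in> set_pmf \<xi>m) \<and>
                (even k \<longrightarrow> real (card (set_pmf \<xi>m)) \<le> real k / 2))"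
    proof (cases "design_index A B \<xi> < real k / 2")
      case True
      then show ?thesis
        using \<xi> small_index_card[OF \<xi> A_neq_B True] moment_class_small_index[OF \<xi> True]
        by (intro exI[of _ \<xi>]) (auto simp: loewner_le_refl)
    next
      case False
      then have "design_index A B \<xi> \<ge> real k / 2" by simp
      with \<xi> obtain \<zeta> where \<zeta>: "\<zeta> \<in> moment_class A B k \<psi> \<xi>"
        "measure_pmf.expectation \<zeta> (\<psi> k) \<ge> measure_pmf.expectation \<xi> (\<psi> k)"
        "design_index A B \<zeta> \<ge> real k / 2"
        "card (set_pmf \<zeta> - (if odd k then {A} else {}) - (if odd (k + k) then {B} else {}))
          \<le> (k - k mod 2) div 2"
        by (rule extremal_design) (rule that)
      have d: "design A B \<zeta>" using \<zeta>(1) by (simp add: moment_class_def)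
      then have fin: "finite (set_pmf \<zeta>)" by (simp add: design_def)
      define n where "n = card (set_pmf \<zeta> - {A, B})"
      note split = card_split_endpoints[OF fin A_neq_B, folded n_def]
        and index = \<zeta>(3)[unfolded design_index_split_endpoints[OF d A_neq_B], folded n_def]
      have odd: "real (card (set_pmf \<zeta>)) \<le> (real k + 1) / 2 \<and> A \<in> set_pmf \<zeta>" if "odd k"
      proof -
        from that obtain m where m: "k = 2 * m + 1" by (rule oddE)
        have "card (set_pmf \<zeta> - {A}) \<le> m" using \<zeta>(4) by (simp add: m)
        \<comment> \<open>The mirror image of the odd case above: now \<open>A\<close> is set aside,
          and the index forces it into the support.\<close>
        then show ?thesis using index unfolding split by (auto simp: m split: if_splits)
      qed
      \<comment> \<open>For even \<open>k = c\<close> no endpoint is set aside, so the bound counts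
        the whole support.\<close>
      have even: "real (card (set_pmf \<zeta>)) \<le> real k / 2" if "even k"
        using that \<zeta>(4) by (auto elim!: evenE)
      show ?thesis
        using d improves[OF \<xi> \<zeta>(1,2)] False odd even
        by (intro exI[of _ \<zeta>]) (cases "even k"; auto)
    qed
  }
qed

end
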